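(* Let $(\Sigma_N,\nu_N,H_N)_{N\ge1}$ be a disordered system as in the context, with free energies $F_N$. Let $\beta_0>0$ and $\delta>0$ be fixed, and suppose there is a nonrandom function $F:(\beta_0-\delta,\beta_0+\delta)\to\mathbb{R}$ such that for every $\beta'\in(\beta_0-\delta,\beta_0+\delta)$, $\lim_{N\to\infty}F_N(\beta')=F(\beta')$ almost surely. Suppose there exist an open interval $J\subseteq(\beta_0-\delta,\beta_0+\delta)$ and a continuous function $E:J\to\mathbb{R}$ such that for every $\beta\in J$ and every $\varepsilon>0$, $$\lim_{N\to\infty}\frac1N\log\int_{\Sigma_N}\mathbf{1}_{\left\{\left|\frac{H_N(\sigma)}{N}-E(\beta)\right|\le\varepsilon\right\}}(\sigma)\,\exp\bigl(\beta H_N(\sigma)\bigr)\,\nu_N(d\sigma)=F(\beta)\quad\text{almost surely}.$$ Then $F$ is differentiable on $J$ and $F'=E$ on $J$.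
   Context: Setting. All random objects are defined on one probability space $(\Omega,\mathcal{A},\mathbb{P})$ with expectation $\mathbb{E}$. For each $N\ge1$, $(\Sigma_N,\mathcal{F}_N)$ is a measurable space, $\nu_N$ is a random probability measure on it, and the Hamiltonian $H_N=(H_N(\sigma))_{\sigma\in\Sigma_N}$ is a real-valued stochastic process indexed by $\Sigma_N$ (jointly measurable in the randomness and $\sigma$), such that $$\mathbb{E}\int_{\Sigma_N}\exp\bigl(b|H_N(\sigma)|\bigr)\,\nu_N(d\sigma)<\infty\quad\text{for all } b>0.$$ For real $b$, the partition function and free energy are the random objects $$Z_N(b)=\int_{\Sigma_N}e^{bH_N(\sigma)}\,\nu_N(d\sigma),\qquad F_N(b)=\frac1N\log Z_N(b).$$ By the integrability assumption, almost surely $0<Z_N(b)<\infty$ for all real $b$. Convention: $\log 0=-\infty$. *)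

theory Defs
  imports "HOL-Probability.Probability"
begin

text \<open>
  The logarithm on \<open>[0, \<infinity>]\<close>, with the conventions \<open>log 0 = -\<infinity>\<close> and \<open>log \<infinity> = \<infinity>\<close>.
\<close>

definition ln_ennreal :: "ennreal \<Rightarrow> ereal" where
  "ln_ennreal x =
     (if x = 0 then -\<infinity> else if x = \<infinity> then \<infinity> else ereal (ln (enn2real x)))"

text \<open>
  \<open>P\<close> is the underlying probability space, \<open>S N\<close> is the measurable space \<open>\<Sigma>\<^sub>N\<close> (only its
  underlying set and sigma-algebra are used), \<open>\<nu> N \<omega>\<close> is the random probability measure and
  \<open>H N \<omega> \<sigma>\<close> the Hamiltonian.  The configuration spaces are all carved out of one type
  \<open>'s\<close> but may differ from one \<open>N\<close> to the next; since any sequence of measurable spaces embeds in a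
  disjoint union, this is no restriction.
\<close>

locale disordered_system = prob_space P
  for P :: "'w measure"
    and S :: "nat \<Rightarrow> 's measure"
    and \<nu> :: "nat \<Rightarrow> 'w \<Rightarrow> 's measure"
    and H :: "nat \<Rightarrow> 'w \<Rightarrow> 's \<Rightarrow> real" +
  assumes random_measure: "\<And>N. 1 \<le> N \<Longrightarrow> \<nu> N \<in> P \<rightarrow>\<^sub>M prob_algebra (S N)"
    and hamiltonian: "\<And>N. 1 \<le> N \<Longrightarrow> (\<lambda>(\<omega>, \<sigma>). H N \<omega> \<sigma>) \<in> borel_measurable (P \<Otimes>\<^sub>M S N)"
    and exp_integrable:
      "\<And>N b. 1 \<le> N \<Longrightarrow> 0 < b \<Longrightarrow>
         (\<integral>\<^sup>+\<omega>. (\<integral>\<^sup>+\<sigma>. ennreal (exp (b * \<bar>H N \<omega> \<sigma>\<bar>)) \<partial>\<nu> N \<omega>) \<partial>P) < \<infinity>"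

definition partition_function ::
  "(nat \<Rightarrow> 'w \<Rightarrow> 's measure) \<Rightarrow> (nat \<Rightarrow> 'w \<Rightarrow> 's \<Rightarrow> real) \<Rightarrow> nat \<Rightarrow> real \<Rightarrow> 'w \<Rightarrow> ennreal"
where
  "partition_function \<nu> H N b \<omega> = (\<integral>\<^sup>+\<sigma>. ennreal (exp (b * H N \<omega> \<sigma>)) \<partial>\<nu> N \<omega>)"

definition free_energy ::
  "(nat \<Rightarrow> 'w \<Rightarrow> 's measure) \<Rightarrow> (nat \<Rightarrow> 'w \<Rightarrow> 's \<Rightarrow> real) \<Rightarrow> nat \<Rightarrow> real \<Rightarrow> 'w \<Rightarrow> ereal"
where
  "free_energy \<nu> H N b \<omega> = ereal (1 / real N) * ln_ennreal (partition_function \<nu> H N b \<omega>)"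

end

theory Submission
  imports Defs
begin

text \<open>
  On the set where \<open>H\<^sub>N / N\<close> is within \<open>\<epsilon>\<close> of \<open>E(\<beta>)\<close>, changing the inverse temperature from \<open>\<beta>\<close> to
  \<open>\<beta>'\<close> costs at least a factor \<open>exp(N ((\<beta>' - \<beta>) E(\<beta>) - \<bar>\<beta>' - \<beta>\<bar> \<epsilon>))\<close>. Restricting the partition function to
  this set and letting \<open>N \<rightarrow> \<infinity>\<close>, then \<open>\<epsilon> \<rightarrow> 0\<close>, shows that \<open>E(\<beta>)\<close> is a subgradient of \<open>F\<close> at \<open>\<beta>\<close>.
  A function with a continuous selection of subgradients is differentiable, with that selection
  as its derivative.
\<close>

lemma ln_ennreal_mono:
  assumes "x \<le> y"
  shows "ln_ennreal x \<le> ln_ennreal y"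
  using assms
  by (cases x; cases y) (auto simp: ln_ennreal_def ennreal_eq_0_iff top_unique)

text \<open>The factor is positive and finite, so multiplying by it fixes both 0 and \<infinity>,
  and the additive rule extends to these values.\<close>

lemma ln_ennreal_exp_mult: "ln_ennreal (ennreal (exp c) * x) = ereal c + ln_ennreal x"
proof (cases x)
  case (real r)
  show ?thesis
  proof (cases "r = 0")
    case False
    with real have "ennreal (exp c) * x = ennreal (exp c * r)" "0 < r"
      by (simp_all add: ennreal_mult)
    with real show ?thesis
      by (simp add: ln_ennreal_def ln_mult ennreal_eq_0_iff not_le)
  qed (use real in \<open>simp add: ln_ennreal_def\<close>)
qed (simp add: ln_ennreal_def ennreal_mult_top)

text \<open>Subgradients at both endpoints trap the difference quotient between \<open>E x\<close>
  and \<open>E y\<close>; continuity of \<open>E\<close> closes the gap.\<close>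

lemma has_real_derivative_of_subgradient:
  fixes F E :: "real \<Rightarrow> real"
  assumes "open J" "continuous_on J E" "x \<in> J"
    and subgradient: "\<And>x y. x \<in> J \<Longrightarrow> y \<in> J \<Longrightarrow> F x + (y - x) * E x \<le> F y"
  shows "(F has_real_derivative E x) (at x)"
proof -
  have "E \<midarrow>x\<rightarrow> E x"
    using assms(1-3) continuous_on_eq_continuous_at continuous_at by blast
  then have lim: "((\<lambda>y. \<bar>E y - E x\<bar>) \<longlongrightarrow> 0) (at x)"
    by (intro tendsto_rabs_zero) (rule LIM_zero)
  have "\<bar>(F y - F x) / (y - x) - E x\<bar> \<le> \<bar>E y - E x\<bar>" if "y \<in> J" "y \<noteq> x" for y
  proof -
    \<comment> \<open>The subgradient at \<open>x\<close> makes the left quantity nonnegative; the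
      one at \<open>y\<close> bounds it by \<open>(E y - E x) * (y - x)\<close>.\<close>
    have "\<bar>F y - F x - E x * (y - x)\<bar> \<le> \<bar>(E y - E x) * (y - x)\<bar>"
      using subgradient[of x y] subgradient[of y x] that \<open>x \<in> J\<close>
      by (simp add: algebra_simps)
    then have "\<bar>F y - F x - E x * (y - x)\<bar> / \<bar>y - x\<bar> \<le> \<bar>E y - E x\<bar>"
      using that by (simp add: abs_mult pos_divide_le_eq)
    moreover have "(F y - F x) / (y - x) - E x = (F y - F x - E x * (y - x)) / (y - x)"
      using that by (simp add: field_simps)
    ultimately show ?thesis
      by simp
  qed
  then have "\<forall>\<^sub>F y in at x. norm ((F y - F x) / (y - x) - E x) \<le> \<bar>E y - E x\<bar>"
    using assms(1,3) by (auto simp: eventually_at_topological)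
  then have "((\<lambda>y. (F y - F x) / (y - x) - E x) \<longlongrightarrow> 0) (at x)"
    by (rule Lim_null_comparison) (rule lim)
  then show ?thesis
    by (simp add: has_field_derivative_iff LIM_zero_iff)
qed

context disordered_system
begin

lemma
  assumes "1 \<le> N" "\<omega> \<in> space P"
  shows sets_random_measure: "sets (\<nu> N \<omega>) = sets (S N)"
    and hamiltonian_measurable: "H N \<omega> \<in> borel_measurable (\<nu> N \<omega>)"
proof -
  have "\<nu> N \<omega> \<in> space (prob_algebra (S N))"
    using random_measure[OF assms(1)] assms(2) by (rule measurable_space)
  then show sets: "sets (\<nu> N \<omega>) = sets (S N)"
    by (simp add: space_prob_algebra)
  have "(\<lambda>\<sigma>. (\<lambda>(\<omega>, \<sigma>). H N \<omega> \<sigma>) (\<omega>, \<sigma>)) \<in> borel_measurable (S N)"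
    by (rule measurable_compose[OF measurable_Pair1'[OF assms(2)] hamiltonian[OF assms(1)]])
  then show "H N \<omega> \<in> borel_measurable (\<nu> N \<omega>)"
    by (simp add: measurable_cong_sets[OF sets refl])
qed

text \<open>The bound holds for each fixed \<open>N\<close> and outcome; almost sure statements
  enter only with the limits. The centre \<open>e\<close> is free here and becomes
  \<open>E \<beta>\<close> later.\<close>

lemma free_energy_ge_restricted:
  fixes \<beta> \<beta>' e \<epsilon> :: real
  assumes N: "1 \<le> N" and \<omega>: "\<omega> \<in> space P"
  shows "ereal ((\<beta>' - \<beta>) * e - \<bar>\<beta>' - \<beta>\<bar> * \<epsilon>) + ereal (1 / real N) *
      ln_ennreal (\<integral>\<^sup>+\<sigma>. indicator {\<sigma> \<in> space (S N). \<bar>H N \<omega> \<sigma> / real N - e\<bar> \<le> \<epsilon>} \<sigma>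
        * ennreal (exp (\<beta> * H N \<omega> \<sigma>)) \<partial>\<nu> N \<omega>)
    \<le> free_energy \<nu> H N \<beta>' \<omega>"
    (is "ereal ?k + _ * ln_ennreal ?A \<le> _")
proof -
  let ?B = "{\<sigma> \<in> space (S N). \<bar>H N \<omega> \<sigma> / real N - e\<bar> \<le> \<epsilon>}"
  have [measurable]: "H N \<omega> \<in> borel_measurable (\<nu> N \<omega>)"
    by (rule hamiltonian_measurable[OF N \<omega>])
  have "space (S N) = space (\<nu> N \<omega>)"
    using sets_random_measure[OF N \<omega>] sets_eq_imp_space_eq by metis
  then have [measurable]: "?B \<in> sets (\<nu> N \<omega>)"
    by simp
  \<comment> \<open>The window is two-sided, so the loss
    \<open>\<bar>\<beta>' - \<beta>\<bar> * \<epsilon>\<close> covers either sign of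
    \<open>\<beta>' - \<beta>\<close>.\<close>
  have pointwise: "real N * ?k + \<beta> * h \<le> \<beta>' * h" if "\<bar>h / real N - e\<bar> \<le> \<epsilon>" for h
  proof -
    have "\<bar>(\<beta>' - \<beta>) * (h / real N - e)\<bar> \<le> \<bar>\<beta>' - \<beta>\<bar> * \<epsilon>"
      unfolding abs_mult using that by (intro mult_left_mono) auto
    then have "?k \<le> (\<beta>' - \<beta>) * (h / real N)"
      by (simp add: algebra_simps)
    then have "real N * ?k \<le> real N * ((\<beta>' - \<beta>) * (h / real N))"
      by (intro mult_left_mono) auto
    also have "\<dots> = (\<beta>' - \<beta>) * h"
      using N by simp
    finally show ?thesis
      by (simp add: algebra_simps)
  qed
  have "ennreal (exp (real N * ?k)) * ?A
      = (\<integral>\<^sup>+\<sigma>. ennreal (exp (real N * ?k)) * (indicator ?B \<sigma> * ennreal (exp (\<beta> * H N \<omega> \<sigma>))) \<partial>\<nu> N \<omega>)"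
    by (rule nn_integral_cmult[symmetric]) measurable
  also have "\<dots> \<le> partition_function \<nu> H N \<beta>' \<omega>"
    unfolding partition_function_def
  proof (rule nn_integral_mono)
    fix \<sigma>
    show "ennreal (exp (real N * ?k)) * (indicator ?B \<sigma> * ennreal (exp (\<beta> * H N \<omega> \<sigma>)))
        \<le> ennreal (exp (\<beta>' * H N \<omega> \<sigma>))"
    proof (cases "\<sigma> \<in> ?B")
      case True
      then have "exp (real N * ?k) * exp (\<beta> * H N \<omega> \<sigma>) \<le> exp (\<beta>' * H N \<omega> \<sigma>)"
        unfolding mult_exp_exp by (subst exp_le_cancel_iff, intro pointwise) blast
      with True show ?thesis
        by (simp only: indicator_simps mult_1_left ennreal_mult''[symmetric] exp_ge_zero ennreal_leI)
    qed simp
  qed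
  finally have "ereal (real N * ?k) + ln_ennreal ?A \<le> ln_ennreal (partition_function \<nu> H N \<beta>' \<omega>)"
    unfolding ln_ennreal_exp_mult[symmetric] by (rule ln_ennreal_mono)
  then have "ereal (1 / real N) * (ereal (real N * ?k) + ln_ennreal ?A) \<le> free_energy \<nu> H N \<beta>' \<omega>"
    unfolding free_energy_def by (intro ereal_mult_left_mono) auto
  \<comment> \<open>The logarithm is -\<infinity> when \<open>?A\<close> vanishes, so distributivity
    is checked case by case.\<close>
  moreover have "ereal (1 / real N) * (ereal (real N * ?k) + ln_ennreal ?A)
      = ereal ?k + ereal (1 / real N) * ln_ennreal ?A"
    using N by (cases "ln_ennreal ?A") (auto simp: field_simps)
  ultimately show ?thesis
    by simp
qed

text \<open>For each \<epsilon> the finite-\<open>N\<close> bound passes to the limit almost surely.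
  The resulting inequality is deterministic, so the exceptional null set may depend on \<epsilon>
  when \<epsilon> then shrinks to 0.\<close>

lemma limit_free_energy_subgradient:
  fixes \<beta> \<beta>' e a b :: real
  assumes free_energy_lim: "AE \<omega> in P. (\<lambda>N. free_energy \<nu> H N \<beta>' \<omega>) \<longlonglongrightarrow> ereal b"
    and restricted_lim: "\<And>\<epsilon>. 0 < \<epsilon> \<Longrightarrow>
      AE \<omega> in P.
        (\<lambda>N. ereal (1 / real N) *
          ln_ennreal (\<integral>\<^sup>+\<sigma>. indicator {\<sigma> \<in> space (S N). \<bar>H N \<omega> \<sigma> / real N - e\<bar> \<le> \<epsilon>} \<sigma>
            * ennreal (exp (\<beta> * H N \<omega> \<sigma>)) \<partial>\<nu> N \<omega>))
        \<longlonglongrightarrow> ereal a"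
  shows "a + (\<beta>' - \<beta>) * e \<le> b"
proof -
  have approx: "a + (\<beta>' - \<beta>) * e \<le> b + \<bar>\<beta>' - \<beta>\<bar> * \<epsilon>" if "0 < \<epsilon>" for \<epsilon>
  proof -
    have "AE \<omega> in P. ereal ((\<beta>' - \<beta>) * e - \<bar>\<beta>' - \<beta>\<bar> * \<epsilon>) + ereal a \<le> ereal b"
      using free_energy_lim restricted_lim[OF that] AE_space
    proof eventually_elim
      case (elim \<omega>)
      show ?case
      proof (rule tendsto_le[OF sequentially_bot elim(1)])
        show "(\<lambda>N. ereal ((\<beta>' - \<beta>) * e - \<bar>\<beta>' - \<beta>\<bar> * \<epsilon>) + ereal (1 / real N) *
            ln_ennreal (\<integral>\<^sup>+\<sigma>. indicator {\<sigma> \<in> space (S N). \<bar>H N \<omega> \<sigma> / real N - e\<bar> \<le> \<epsilon>} \<sigma>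
              * ennreal (exp (\<beta> * H N \<omega> \<sigma>)) \<partial>\<nu> N \<omega>))
          \<longlonglongrightarrow> ereal ((\<beta>' - \<beta>) * e - \<bar>\<beta>' - \<beta>\<bar> * \<epsilon>) + ereal a"
          \<comment> \<open>Both limits are finite, which rules out \<infinity> -
            \<infinity>.\<close>
          by (intro tendsto_add_ereal tendsto_const elim(2)) auto
      qed (use free_energy_ge_restricted[OF _ elim(3)] in \<open>auto intro!: eventually_sequentiallyI[of 1]\<close>)
    qed
    \<comment> \<open>The inequality does not involve the outcome, and a probability space is not
      null, so it holds outright.\<close>
    then show ?thesis
      by simp
  qed
  show ?thesis
  proof (rule field_le_epsilon)
    fix \<eta> :: real
    assume "0 < \<eta>"
    \<comment> \<open>The added 1 keeps the denominator positive when
      \<open>\<beta>' = \<beta>\<close>.\<close>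
    have "\<bar>\<beta>' - \<beta>\<bar> * (\<eta> / (\<bar>\<beta>' - \<beta>\<bar> + 1)) \<le> \<eta>"
      using \<open>0 < \<eta>\<close> by (simp add: field_simps)
    with approx[of "\<eta> / (\<bar>\<beta>' - \<beta>\<bar> + 1)"] \<open>0 < \<eta>\<close> show "a + (\<beta>' - \<beta>) * e \<le> b + \<eta>"
      by simp
  qed
qed

end

theorem theorem2:
  fixes P :: "'w measure"
    and S :: "nat \<Rightarrow> 's measure"
    and \<nu> :: "nat \<Rightarrow> 'w \<Rightarrow> 's measure"
    and H :: "nat \<Rightarrow> 'w \<Rightarrow> 's \<Rightarrow> real"
    and F E :: "real \<Rightarrow> real"
    and \<beta>\<^sub>0 \<delta> :: real
    and J :: "real set"
  assumes "disordered_system P S \<nu> H"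
    and "0 < \<beta>\<^sub>0" and "0 < \<delta>"
    and "\<And>\<beta>'. \<beta>' \<in> {\<beta>\<^sub>0 - \<delta><..<\<beta>\<^sub>0 + \<delta>} \<Longrightarrow>
           AE \<omega> in P. (\<lambda>N. free_energy \<nu> H N \<beta>' \<omega>) \<longlonglongrightarrow> ereal (F \<beta>')"
    and "open J" and "is_interval J" and "J \<subseteq> {\<beta>\<^sub>0 - \<delta><..<\<beta>\<^sub>0 + \<delta>}"
    and "continuous_on J E"
    and "\<And>\<beta> \<epsilon>. \<beta> \<in> J \<Longrightarrow> 0 < \<epsilon> \<Longrightarrow>
           AE \<omega> in P.
             (\<lambda>N. ereal (1 / real N) *
                ln_ennreal (\<integral>\<^sup>+\<sigma>. indicator {\<sigma> \<in> space (S N). \<bar>H N \<omega> \<sigma> / real N - E \<beta>\<bar> \<le> \<epsilon>} \<sigma>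
                                  * ennreal (exp (\<beta> * H N \<omega> \<sigma>)) \<partial>\<nu> N \<omega>))
             \<longlonglongrightarrow> ereal (F \<beta>)"
  shows "\<forall>\<beta>\<in>J. (F has_real_derivative E \<beta>) (at \<beta>)"
proof -
  interpret disordered_system P S \<nu> H
    by fact
  \<comment> \<open>Concentration is used at \<open>x\<close>, convergence of the free energy at
    \<open>y\<close>.\<close>
  have "F x + (y - x) * E x \<le> F y" if "x \<in> J" "y \<in> J" for x y
    using assms(4)[of y] assms(9)[OF \<open>x \<in> J\<close>] assms(7) that
    by (intro limit_free_energy_subgradient) auto
  then show ?thesis
    using assms(5,8) by (blast intro: has_real_derivative_of_subgradient)
qed

end
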